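(* Let $M\in C(\mathbb{R}^n\to \mathbf{Gl}_n(\mathbb{R}))$, $f\in C(\mathbb{R}^n\times\mathbb{R}^n\to\mathbb{R}^n)$, $B\in C(\mathbb{R}^n\to\mathbb{R}^{n\times m})$, $h\in C^1(\mathbb{R}^n\to\mathbb{R}^m)$, and $H(x_1):=h'(x_1)$. Consider the system $$\dot q(t)=v(t),\quad M(q(t))\dot v(t)=f(q(t),v(t))+B(q(t))u(t),\quad y(t)=h(q(t)),$$ with initial values $q(0)=q^0\in\mathbb{R}^n$, $v(0)=v^0\in\mathbb{R}^n$, input $u$ and output $y$. Let $U_1\subseteq\mathbb{R}^n$ be open and suppose $\Gamma(x_1):=H(x_1)M(x_1)^{-1}B(x_1)\in\mathbf{Gl}_m(\mathbb{R})$ for all $x_1\in U_1$. Let $\phi_1\in C^1(U_1\to\mathbb{R}^{n-m})$ be such that $\begin{bmatrix}H(x_1)\\ \phi_1'(x_1)\end{bmatrix}\in\mathbf{Gl}_n(\mathbb{R})$ for all $x_1\in U_1$. Let $V\in C(U_1\to\mathbb{R}^{n\times(n-m)})$ have orthonormal columns with $\operatorname{im}V(x_1)=\ker H(x_1)$ for all $x_1\in U_1$, and set $$\phi_2(x_1):=V^\dagger(x_1)\big(I_n-M(x_1)^{-1}B(x_1)\Gamma(x_1)^{-1}H(x_1)\big),\qquad x_1\in U_1.$$ Then $\varphi(x_1):=\begin{pmatrix}h(x_1)\\ \phi_1(x_1)\end{pmatrix}$ defines a diffeomorphism on $U_1$ (onto $W_1:=\varphi(U_1)$). Moreover, as long as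 $q(t)\in U_1$, with the internal state $\eta_1(t):=\phi_1(q(t))$, $\eta_2(t):=\phi_2(q(t))v(t)$, and with $w(t):=\begin{pmatrix}y(t)\\ \eta_1(t)\end{pmatrix}$, $\omega(t):=\begin{pmatrix}\dot y(t)\\ \eta_2(t)\end{pmatrix}$, the internal dynamics of the system are given by $$\dot\eta_1=\phi'_{1,\varphi}(w)\,M_\varphi(w)^{-1}B_\varphi(w)\Gamma_\varphi(w)^{-1}\dot y+\phi'_{1,\varphi}(w)\,V_\varphi(w)\,\eta_2,$$ $$\dot\eta_2=\phi'_{2,\varphi}[w,\omega]\Big(M_\varphi(w)^{-1}B_\varphi(w)\Gamma_\varphi(w)^{-1}\dot y+V_\varphi(w)\eta_2\Big)+\phi_{2,\varphi}(w)\,M_\varphi(w)^{-1}f_\varphi(w,\omega)$$ (all functions of time evaluated at $t$); in particular the input $u$ does not appear explicitly.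
   Context: $\mathbf{Gl}_k(\mathbb{R})$ is the group of invertible real $k\times k$ matrices; $V^\dagger(x_1)=(V(x_1)^\top V(x_1))^{-1}V(x_1)^\top$ is the pseudoinverse. For a function $A$ on $U_1$ write $A_\varphi:=A\circ\varphi^{-1}$ on $W_1$; thus $\phi'_{1,\varphi}=\phi_1'\circ\varphi^{-1}$, $M_\varphi=M\circ\varphi^{-1}$, $B_\varphi=B\circ\varphi^{-1}$, $H_\varphi=H\circ\varphi^{-1}$, $\Gamma_\varphi=\Gamma\circ\varphi^{-1}$, $V_\varphi=V\circ\varphi^{-1}$, $\phi_{2,\varphi}=\phi_2\circ\varphi^{-1}$. Write $\phi_2'[x_1,x_2]:=\frac{\partial}{\partial x_1}[\phi_2(x_1)\cdot x_2]\in\mathbb{R}^{(n-m)\times n}$ for $x_1\in U_1$, $x_2\in\mathbb{R}^n$. For $w\in W_1$, $\omega\in\mathbb{R}^n$: $$\phi'_{2,\varphi}[w,\omega]:=\phi_2'\left[\varphi^{-1}(w),\begin{bmatrix}H_\varphi(w)\\ \phi_{2,\varphi}(w)\end{bmatrix}^{-1}\omega\right],\qquad f_\varphi(w,\omega):=f\left(\varphi^{-1}(w),\begin{bmatrix}H_\varphi(w)\\ \phi_{2,\varphi}(w)\end{bmatrix}^{-1}\omega\right),$$ where the inverse exists and equals $\begin{bmatrix}M_\varphi(w)^{-1}B_\varphi(w)\Gamma_\varphi(w)^{-1} & V_\varphi(w)\end{bmatrix}$.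
   Formalization: φ need not be injective on U_1, so it is shown to be a diffeomorphism locally and on every open U⊆U_1 where it is injective; the dynamics are stated for q(t)∈U. The η_2 equation assumes φ_2 differentiable at q(t). The degenerate cases m=0 and m=n are excluded. *)

theory Defs
  imports "HOL-Analysis.Analysis"
begin

definition C1_on :: "(real^'a \<Rightarrow> real^'b) \<Rightarrow> (real^'a) set \<Rightarrow> bool" where
  "C1_on g S \<longleftrightarrow>
     (\<forall>x\<in>S. g differentiable (at x)) \<and> continuous_on S (\<lambda>x. jacobian g (at x))"

definition C1_diffeomorphism_on :: "(real^'a \<Rightarrow> real^'b) \<Rightarrow> (real^'a) set \<Rightarrow> bool" where
  "C1_diffeomorphism_on g S \<longleftrightarrow>
     open S \<and> inj_on g S \<and> C1_on g S \<and>
     open (g ` S) \<and> C1_on (inv_into S g) (g ` S)"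

text \<open>Blocks placed on top of each other. Since a matrix is a vector of its rows, this serves
  both for vectors and, row-wise, for matrices.\<close>

definition vstack :: "'a^'m \<Rightarrow> 'a^'k \<Rightarrow> 'a^('m + 'k)" where
  "vstack a b = (\<chi> i. case i of Inl j \<Rightarrow> a $ j | Inr j \<Rightarrow> b $ j)"

definition hstack :: "'a^'m^'n \<Rightarrow> 'a^'k^'n \<Rightarrow> 'a^('m + 'k)^'n" where
  "hstack A B = (\<chi> i. vstack (A $ i) (B $ i))"

text \<open>The left inverse for full column rank; it is only used for such matrices.\<close>

definition pseudoinverse :: "real^'k^'n \<Rightarrow> real^'n^'k" where
  "pseudoinverse A = matrix_inv (transpose A ** A) ** transpose A"

definition orthonormal_columns :: "real^'k^'n \<Rightarrow> bool" where
  "orthonormal_columns A \<longleftrightarrow>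
     (\<forall>i j. column i A \<bullet> column j A = (if i = j then 1 else 0))"

definition matrix_im :: "real^'k^'n \<Rightarrow> (real^'n) set" where
  "matrix_im A = range (\<lambda>x. A *v x)"

definition matrix_ker :: "real^'k^'n \<Rightarrow> (real^'k) set" where
  "matrix_ker A = {x. A *v x = 0}"

text \<open>For a matrix-valued \<open>P\<close>, the derivative of \<open>x \<mapsto> P x \<cdot> z\<close> with \<open>z\<close> held fixed.\<close>

definition deriv_applied ::
    "(real^'n \<Rightarrow> real^'n^'k) \<Rightarrow> real^'n \<Rightarrow> real^'n \<Rightarrow> real^'n^'k" where
  "deriv_applied P x z = jacobian (\<lambda>x'. P x' *v z) (at x)"

text \<open>Classical solutions on the time interval \<open>I\<close>; derivatives are one-sided at end points
  of \<open>I\<close> that belong to \<open>I\<close>.\<close>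

definition solves_system ::
    "(real^'n \<Rightarrow> real^'n^'n) \<Rightarrow> ((real^'n) \<times> (real^'n) \<Rightarrow> real^'n) \<Rightarrow> (real^'n \<Rightarrow> real^'m^'n) \<Rightarrow>
     (real^'n \<Rightarrow> real^'m) \<Rightarrow> real^'n \<Rightarrow> real^'n \<Rightarrow> real set \<Rightarrow>
     (real \<Rightarrow> real^'m) \<Rightarrow> (real \<Rightarrow> real^'n) \<Rightarrow> (real \<Rightarrow> real^'n) \<Rightarrow> (real \<Rightarrow> real^'m) \<Rightarrow> bool" where
  "solves_system M f B h q0 v0 I u q v y \<longleftrightarrow>
     q 0 = q0 \<and> v 0 = v0 \<and>
     (\<forall>t\<in>I. (q has_vector_derivative v t) (at t within I)) \<and>
     (\<forall>t\<in>I. v differentiable (at t within I) \<and>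
        M (q t) *v vector_derivative v (at t within I) = f (q t, v t) + B (q t) *v u t) \<and>
     (\<forall>t\<in>I. y t = h (q t))"

end

theory Submission
  imports Defs
begin

text \<open>With \<open>K = M\<inverse> B \<Gamma>\<inverse>\<close> one has \<open>H K = 1\<close>, \<open>H V = 0\<close>, \<open>\<phi>2 K = 0\<close> and \<open>\<phi>2 V = 1\<close>, so \<open>[K V]\<close>
  inverts the stacked matrix \<open>[H; \<phi>2]\<close>, and the velocity is recovered from the new coordinates
  as \<open>v = K ydot + V \<eta>2\<close>. The chain and product rules give the internal dynamics; since
  \<open>\<phi>2 M\<inverse> B = 0\<close>, the input cancels. The diffeomorphism part is the inverse function theorem,
  where \<open>real^'n\<close> and \<open>real^('m + 'k)\<close> are distinct types of equal dimension, so that the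
  library's inverse function theorem for endomaps does not apply directly.\<close>

section \<open>Stacked matrices and inverses of non-square type\<close>

lemma vstack_mult: "vstack A B ** C = vstack (A ** C) (B ** C)"
  by (auto simp: vec_eq_iff vstack_def matrix_matrix_mult_def split: sum.splits)

lemma vstack_mult_vec: "vstack A B *v x = vstack (A *v x) (B *v x)"
  by (auto simp: vec_eq_iff vstack_def matrix_vector_mult_def split: sum.splits)

lemma mult_hstack: "A ** hstack B C = hstack (A ** B) (A ** C)"
  by (auto simp: vec_eq_iff hstack_def vstack_def matrix_matrix_mult_def split: sum.splits)

lemma hstack_mult_vstack:
  fixes A :: "real^'m^'n" and B :: "real^'k^'n"
  shows "hstack A B *v vstack x y = A *v x + B *v y"
  \<comment> \<open>The index set of a sum type is read as a disjoint union, so that the row sum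
    splits into its two blocks; the default rewriting in the opposite direction is switched
    off.\<close>
  by (simp add: vec_eq_iff hstack_def vstack_def matrix_vector_mult_def
      UNIV_Plus_UNIV[symmetric] sum.Plus del: UNIV_Plus_UNIV)

lemma hstack_vstack_mat_1: "hstack (vstack (mat 1) 0) (vstack 0 (mat 1)) = mat 1"
  by (auto simp: vec_eq_iff hstack_def vstack_def mat_def split: sum.splits)

text \<open>\<open>matrix_inv\<close> chooses a two-sided inverse, and the choice makes sense when
  row and column index types differ. This is the form needed for stacked matrices, which map
  \<open>real^'n\<close> to \<open>real^('m + 'k)\<close>.\<close>

lemma matrix_inv_rect:
  fixes A :: "real^'n^'m"
  assumes "invertible A"
  shows "A ** matrix_inv A = mat 1" "matrix_inv A ** A = mat 1"
proof -
  have "A ** matrix_inv A = mat 1 \<and> matrix_inv A ** A = mat 1"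
    unfolding matrix_inv_def by (rule someI_ex[OF assms[unfolded invertible_def]])
  then show "A ** matrix_inv A = mat 1" "matrix_inv A ** A = mat 1"
    by (rule conjunct1, rule conjunct2)
qed

lemma matrix_inv_unique_rect:
  fixes A :: "real^'n^'m"
  assumes "A ** X = mat 1" "X ** A = mat 1"
  shows "matrix_inv A = X"
proof -
  have "A ** matrix_inv A = mat 1"
    using assms by (intro matrix_inv_rect) (auto simp: invertible_def)
  moreover have "matrix_inv A = (X ** A) ** matrix_inv A"
    using assms by simp
  ultimately show ?thesis
    by (simp flip: matrix_mul_assoc)
qed

text \<open>A right inverse makes \<open>A\<close> surjective, hence injective by equality of
  dimensions; then \<open>A\<close> can be cancelled from \<open>A X A x = A x\<close>.\<close>

lemma matrix_right_inverse_imp_left_inverse: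
  fixes A :: "real^'n^'m"
  assumes card: "CARD('n) = CARD('m)" and AX: "A ** X = mat 1"
  shows "X ** A = mat 1"
proof -
  have "surj ((*v) A)"
    using AX matrix_right_invertible_surjective by blast
  then have "inj ((*v) A)"
    using linear_surjective_imp_injective[of "(*v) A"] card by simp
  moreover have "A *v ((X ** A) *v x) = A *v x" for x
    using AX by (simp add: matrix_vector_mul_assoc matrix_mul_assoc)
  ultimately have "(X ** A) *v x = x" for x
    by (simp add: inj_eq)
  then show ?thesis
    by (simp add: matrix_eq)
qed

section \<open>Continuity and differentiability\<close>

lemma bounded_bilinear_matrix_mult:
  "bounded_bilinear (\<lambda>(A::real^'n^'m) (B::real^'k^'n). A ** B)"
  unfolding bilinear_conv_bounded_bilinear[symmetric] bilinear_def
  by (auto intro!: linearI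
      simp: vec_eq_iff matrix_matrix_mult_def algebra_simps sum.distrib sum_distrib_left)

lemma bounded_bilinear_matrix_vector_mult:
  "bounded_bilinear (\<lambda>(A::real^'n^'m) (x::real^'n). A *v x)"
  unfolding bilinear_conv_bounded_bilinear[symmetric] bilinear_def
  by (auto intro!: linearI simp: matrix_vector_right_distrib matrix_vector_mult_add_rdistrib
      matrix_vector_mult_scaleR scaleR_matrix_vector_assoc)

text \<open>The resolvent identity bounds the difference of the inverses by the difference of the
  matrices times the norm of \<open>matrix_inv (A x)\<close>; this last norm is bounded near the
  limit by absorption.\<close>

lemma tendsto_matrix_inv:
  fixes A :: "'a \<Rightarrow> real^'n^'m"
  assumes lim: "(A \<longlongrightarrow> A0) F" and inv0: "invertible A0" and inv: "\<forall>\<^sub>F x in F. invertible (A x)"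
  shows "((\<lambda>x. matrix_inv (A x)) \<longlongrightarrow> matrix_inv A0) F"
proof -
  interpret l: bounded_bilinear "\<lambda>(A::real^'m^'n) (B::real^'n^'m). A ** B"
    by (rule bounded_bilinear_matrix_mult)
  interpret r: bounded_bilinear "\<lambda>(A::real^'n^'n) (B::real^'m^'n). A ** B"
    by (rule bounded_bilinear_matrix_mult)
  obtain K where K: "K > 0" "\<And>A B. norm ((A::real^'m^'n) ** (B::real^'n^'m)) \<le> norm A * norm B * K"
    using l.pos_bounded by auto
  obtain L where L: "L > 0" "\<And>A B. norm ((A::real^'n^'n) ** (B::real^'m^'n)) \<le> norm A * norm B * L"
    using r.pos_bounded by auto
  define X0 where "X0 = matrix_inv A0"
  define c where "c = norm X0 * K * L"
  have bound: "norm (matrix_inv (A x) - X0) \<le> c * norm (A x - A0) * norm (matrix_inv (A x))"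
    if "invertible (A x)" for x
  proof -
    \<comment> \<open>Expanding the right-hand side gives
      \<open>X0 A A^-1 - X0 A0 A^-1\<close>.\<close>
    have "X0 - matrix_inv (A x) = (X0 ** (A x - A0)) ** matrix_inv (A x)"
      using matrix_inv_rect[OF that] matrix_inv_rect[OF inv0]
      by (simp add: l.diff_right r.diff_left X0_def flip: matrix_mul_assoc)
    then have "norm (X0 - matrix_inv (A x))
        \<le> norm (X0 ** (A x - A0)) * norm (matrix_inv (A x)) * L"
      using L by metis
    also have "\<dots> \<le> (norm X0 * norm (A x - A0) * K) * norm (matrix_inv (A x)) * L"
      using K L by (intro mult_right_mono) auto
    finally show ?thesis
      by (simp add: c_def norm_minus_commute mult_ac)
  qed
  have lim0: "((\<lambda>x. c * norm (A x - A0)) \<longlongrightarrow> 0) F"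
    using tendsto_mult_right_zero[OF tendsto_norm_zero[OF LIM_zero[OF lim]]] .
  \<comment> \<open>With factor 1/2 the triangle inequality reads
    \<open>norm A^-1 \<le> norm X0 + norm A^-1 / 2\<close>, whence the uniform bound
    \<open>2 * norm X0\<close>.\<close>
  have "\<forall>\<^sub>F x in F. c * norm (A x - A0) < 1/2"
    using order_tendstoD(2)[OF lim0, of "1/2"] by linarith
  with inv have "\<forall>\<^sub>F x in F. norm (matrix_inv (A x) - X0) \<le> c * norm (A x - A0) * (2 * norm X0)"
  proof eventually_elim
    case (elim x)
    have c0: "0 \<le> c * norm (A x - A0)"
      using K L by (simp add: c_def)
    have "c * norm (A x - A0) * norm (matrix_inv (A x)) \<le> 1/2 * norm (matrix_inv (A x))"
      using elim by (intro mult_right_mono) auto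
    then have "norm (matrix_inv (A x)) \<le> 2 * norm X0"
      using bound[OF elim(1)] norm_triangle_sub[of "matrix_inv (A x)" X0] by linarith
    then show ?case
      using bound[OF elim(1)] c0 by (meson mult_left_mono order_trans)
  qed
  moreover have "((\<lambda>x. c * norm (A x - A0) * (2 * norm X0)) \<longlongrightarrow> 0) F"
    using tendsto_mult_left_zero[OF lim0] .
  ultimately have "((\<lambda>x. matrix_inv (A x) - X0) \<longlongrightarrow> 0) F"
    by (rule Lim_null_comparison)
  then show ?thesis
    unfolding X0_def by (rule LIM_zero_cancel)
qed

lemma continuous_on_matrix_inv:
  fixes A :: "'a::topological_space \<Rightarrow> real^'n^'m"
  assumes "continuous_on S A" "\<And>x. x \<in> S \<Longrightarrow> invertible (A x)"
  shows "continuous_on S (\<lambda>x. matrix_inv (A x))"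
  unfolding continuous_on
proof
  fix x assume "x \<in> S"
  with assms show "((\<lambda>x. matrix_inv (A x)) \<longlongrightarrow> matrix_inv (A x)) (at x within S)"
    by (intro tendsto_matrix_inv) (auto simp: continuous_on eventually_at_filter)
qed

lemma jacobian_eqI:
  fixes g :: "real^'a \<Rightarrow> real^'b"
  assumes "(g has_derivative g') (at x)" "\<And>z. g' z = A *v z"
  shows "jacobian g (at x) = A"
proof -
  have "frechet_derivative g (at x) = (\<lambda>z. A *v z)"
    using assms by (simp add: frechet_derivative_at[symmetric] fun_eq_iff)
  then show ?thesis
    by (simp add: jacobian_def)
qed

lemma has_derivative_vstack:
  fixes g :: "'c::real_normed_vector \<Rightarrow> real^'a" and k :: "'c \<Rightarrow> real^'b"
  assumes "(g has_derivative g') (at a within S)" "(k has_derivative k') (at a within S)"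
  shows "((\<lambda>x. vstack (g x) (k x)) has_derivative (\<lambda>x. vstack (g' x) (k' x))) (at a within S)"
proof -
  have "linear (\<lambda>p::(real^'a) \<times> (real^'b). vstack (fst p) (snd p))"
    by (intro linearI) (auto simp: vec_eq_iff vstack_def split: sum.splits)
  then have "bounded_linear (\<lambda>p::(real^'a) \<times> (real^'b). vstack (fst p) (snd p))"
    by (simp add: linear_conv_bounded_linear)
  from bounded_linear.has_derivative[OF this has_derivative_Pair[OF assms]]
  show ?thesis by simp
qed

lemma continuous_on_vstack:
  assumes "continuous_on S A" "continuous_on S B"
  shows "continuous_on S (\<lambda>x. vstack (A x) (B x))"
  unfolding vstack_def
proof (rule continuous_on_vec_lambda)
  fix i
  show "continuous_on S (\<lambda>x. case i of Inl j \<Rightarrow> A x $ j | Inr j \<Rightarrow> B x $ j)"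
    using assms by (cases i) (auto intro: continuous_on_component)
qed

section \<open>Inverse function theorem between spaces of different index type\<close>

lemma C1_on_subset: "C1_on g S \<Longrightarrow> T \<subseteq> S \<Longrightarrow> C1_on g T"
  unfolding C1_on_def by (meson continuous_on_subset subsetD)

lemma C1_on_has_derivative:
  "C1_on g S \<Longrightarrow> x \<in> S \<Longrightarrow> (g has_derivative (*v) (jacobian g (at x))) (at x)"
  unfolding C1_on_def using jacobian_works by blast

lemma C1_on_continuous_on: "C1_on g S \<Longrightarrow> continuous_on S g"
  by (intro continuous_at_imp_continuous_on)
    (auto simp: C1_on_def intro: differentiable_imp_continuous_within)

text \<open>A map whose derivative is continuous at \<open>a\<close> in operator norm and left
  invertible there is injective on a ball. What remains is to pass from continuity of the Jacobian
  as a matrix to continuity in operator norm.\<close>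

lemma C1_on_locally_inj:
  fixes g :: "real^'a \<Rightarrow> real^'b"
  assumes "open S" "C1_on g S" "a \<in> S" "invertible (jacobian g (at a))"
  obtains r where "r > 0" "ball a r \<subseteq> S" "inj_on g (ball a r)"
proof (rule has_derivative_locally_injective[of a S "(*v) (matrix_inv (jacobian g (at a)))"
      "\<lambda>x. (*v) (jacobian g (at x))" g])
  show "(*v) (matrix_inv (jacobian g (at a))) \<circ> (*v) (jacobian g (at a)) = id"
    by (simp add: fun_eq_iff matrix_vector_mul_assoc matrix_inv_rect[OF assms(4)])
  fix e :: real assume "e > 0"
  obtain K where K: "K > 0" "\<And>A x. norm ((A::real^'a^'b) *v x) \<le> norm A * norm x * K"
    using bounded_bilinear.pos_bounded[OF bounded_bilinear_matrix_vector_mult] by blast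
  have "isCont (\<lambda>x. jacobian g (at x)) a"
    using assms by (auto simp: C1_on_def continuous_on_eq_continuous_at)
  \<comment> \<open>\<open>K\<close> compares the matrix norm with the operator norm; the extra
    factor 2 leaves \<open>e / 2\<close>, hence the strict inequality \<open>< e\<close> for
    \<open>onorm\<close>.\<close>
  then have "\<forall>\<^sub>F x in nhds a. dist (jacobian g (at x)) (jacobian g (at a)) < e / (2 * K)"
    using \<open>e > 0\<close> K unfolding isCont_def tendsto_iff eventually_at_filter
    by (auto elim!: allE[of _ "e / (2 * K)"] eventually_mono)
  then obtain d where d: "d > 0"
      "\<And>x. dist x a < d \<Longrightarrow> dist (jacobian g (at x)) (jacobian g (at a)) < e / (2 * K)"
    unfolding eventually_nhds_metric by blast
  show "\<exists>d>0. \<forall>x. dist a x < d \<longrightarrow>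
      onorm (\<lambda>v. jacobian g (at x) *v v - jacobian g (at a) *v v) < e"
  proof (intro exI[of _ d] conjI allI impI)
    fix x assume "dist a x < d"
    then have "norm (jacobian g (at x) - jacobian g (at a)) < e / (2 * K)"
      using d(2)[of x] by (simp add: dist_commute flip: dist_norm)
    then have *: "norm (jacobian g (at x) - jacobian g (at a)) * K \<le> e / 2"
      using K by (simp add: field_simps)
    have "onorm (\<lambda>v. (jacobian g (at x) - jacobian g (at a)) *v v) \<le> e / 2"
    proof (rule onorm_le)
      fix v
      have "norm ((jacobian g (at x) - jacobian g (at a)) *v v)
          \<le> (norm (jacobian g (at x) - jacobian g (at a)) * K) * norm v"
        using K(2)[of "jacobian g (at x) - jacobian g (at a)" v] by (simp add: mult_ac)
      also have "\<dots> \<le> e / 2 * norm v"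
        using * by (rule mult_right_mono) simp
      finally show "norm ((jacobian g (at x) - jacobian g (at a)) *v v) \<le> e / 2 * norm v" .
    qed
    then show "onorm (\<lambda>v. jacobian g (at x) *v v - jacobian g (at a) *v v) < e"
      using \<open>e > 0\<close> by (simp add: matrix_vector_mult_diff_rdistrib)
  qed (rule d)
qed (use assms that C1_on_has_derivative in auto)

text \<open>Right inverses of the derivatives make \<open>g\<close> an open map, so its inverse is
  continuous. A continuous inverse is differentiable wherever the derivative of \<open>g\<close> is
  invertible, and its Jacobian \<open>matrix_inv (?J (?k y))\<close> is continuous because matrix
  inversion is.\<close>

lemma C1_diffeomorphism_onI:
  fixes g :: "real^'a \<Rightarrow> real^'b"
  assumes S: "open S" and C1: "C1_on g S" and inj: "inj_on g S"
    and inv: "\<And>x. x \<in> S \<Longrightarrow> invertible (jacobian g (at x))"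
  shows "C1_diffeomorphism_on g S"
proof -
  let ?J = "\<lambda>x. jacobian g (at x)" and ?k = "inv_into S g"
  have cont: "continuous_on S g"
    by (rule C1_on_continuous_on[OF C1])
  \<comment> \<open>All open \<open>T\<close> inside \<open>S\<close> are treated, not only
    \<open>S\<close>, because openness of these images is what makes \<open>?k\<close>
    continuous.\<close>
  have open_image: "open (g ` T)" if T: "open T" "T \<subseteq> S" for T
  proof -
    have "g x \<in> interior (g ` T)" if "x \<in> T" for x
    proof (rule sussmann_open_mapping[OF S cont])
      show "(*v) (?J x) \<circ> (*v) (matrix_inv (?J x)) = id"
        using T that matrix_inv_rect[OF inv, of x]
        by (auto simp: fun_eq_iff matrix_vector_mul_assoc)
    qed (use T that C1 C1_on_has_derivative in \<open>auto simp: interior_open\<close>)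
    then show ?thesis
      by (metis image_subsetI interior_subset open_interior subset_antisym)
  qed
  have contk: "continuous_on (g ` S) ?k"
    by (rule continuous_on_inverse_open_map[OF cont refl])
      (use inj S open_image in \<open>auto simp: openin_open_eq\<close>)
  have "(?k has_derivative (*v) (matrix_inv (?J (?k y)))) (at y)" if y: "y \<in> g ` S" for y
  proof (rule has_derivative_inverse_basic)
    have ky: "?k y \<in> S"
      using y by (rule inv_into_into)
    show "(g has_derivative (*v) (?J (?k y))) (at (?k y))"
      by (rule C1_on_has_derivative[OF C1 ky])
    show "(*v) (matrix_inv (?J (?k y))) \<circ> (*v) (?J (?k y)) = id"
      using matrix_inv_rect[OF inv[OF ky]] by (simp add: fun_eq_iff matrix_vector_mul_assoc)
    show "continuous (at y) ?k"
      using contk y open_image[OF S order_refl] continuous_on_eq_continuous_at by blast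
  qed (use y open_image[OF S] in \<open>auto simp: f_inv_into_f\<close>)
  note der = this
  have "continuous_on (g ` S) (\<lambda>y. matrix_inv (?J (?k y)))"
  proof (rule continuous_on_matrix_inv)
    show "continuous_on (g ` S) (\<lambda>y. ?J (?k y))"
      by (rule continuous_on_compose2[OF _ contk]) (use C1 in \<open>auto simp: C1_on_def inv_into_into\<close>)
  qed (use inv in \<open>auto simp: inv_into_into\<close>)
  moreover have "jacobian ?k (at y) = matrix_inv (?J (?k y))" if "y \<in> g ` S" for y
    using jacobian_eqI[OF der[OF that]] by simp
  ultimately have "C1_on ?k (g ` S)"
    unfolding C1_on_def using der differentiableI by (simp cong: continuous_on_cong) blast
  then show ?thesis
    using S C1 inj open_image unfolding C1_diffeomorphism_on_def by blast
qed

section \<open>The internal dynamics\<close>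

text \<open>The Gram matrix of orthonormal columns is the identity, so the inverse in
  \<open>pseudoinverse\<close> drops out.\<close>

lemma pseudoinverse_orthonormal:
  assumes "orthonormal_columns A"
  shows "pseudoinverse A ** A = mat 1"
proof -
  have "transpose A ** A = mat 1"
    using assms
    by (simp add: orthonormal_columns_def vec_eq_iff matrix_matrix_mult_def transpose_def mat_def
        column_def inner_vec_def)
  moreover have "matrix_inv (mat 1 :: real^'a^'a) = mat 1"
    by (rule matrix_inv_unique_rect) simp_all
  ultimately show ?thesis
    by (simp add: pseudoinverse_def flip: matrix_mul_assoc)
qed

lemma matrix_im_le_ker_mult:
  assumes "matrix_im V \<subseteq> matrix_ker H"
  shows "H ** V = 0"
proof -
  have "(H ** V) *v x = 0" for x
    using assms by (auto simp: matrix_im_def matrix_ker_def simp flip: matrix_vector_mul_assoc)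
  then show ?thesis
    by (simp add: matrix_eq)
qed

text \<open>A connected set with more than one point has no isolated points. This makes derivatives
  within \<open>I\<close> unique, so that \<open>ydot\<close>, given through
  \<open>vector_derivative\<close>, can be computed by the chain rule.\<close>

lemma interval_at_within_neq_bot:
  fixes I :: "real set"
  assumes "is_interval I" "a \<in> I" "I \<noteq> {a}" "t \<in> I"
  shows "at t within I \<noteq> bot"
proof -
  have "t islimpt I"
    using assms connected_imp_perfect[of I t] is_interval_connected by blast
  then show ?thesis
    by (simp add: trivial_limit_within)
qed

text \<open>Allows \<open>\<eta>1\<close> and \<open>\<eta>2\<close>, which are prescribed only
  while \<open>q\<close> is in \<open>U1\<close>, to be replaced by their formulas when
  differentiating at \<open>t\<close>.\<close>

lemma eventually_mem_open_within:
  assumes "continuous (at t within I) q" "open U" "q t \<in> U"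
  shows "\<forall>\<^sub>F s in at t within I. q s \<in> U"
  using assms topological_tendstoD unfolding continuous_within by blast

text \<open>Invertible Jacobians give injectivity only locally, so the coordinate form of the
  dynamics is stated on every open \<open>U\<close> where \<open>\<phi>\<close> is injective.
  Continuity of \<open>M\<close>, \<open>B\<close>, \<open>V\<close> and \<open>H\<close> does not
  make \<open>\<phi>2\<close> differentiable, so the equation for \<open>\<eta>2\<close> is
  conditional on differentiability at \<open>q t\<close>.\<close>

theorem mainTheorem1:
  fixes M :: "real^'n \<Rightarrow> real^'n^'n"
    and f :: "(real^'n) \<times> (real^'n) \<Rightarrow> real^'n"
    and B :: "real^'n \<Rightarrow> real^'m^'n"
    and h :: "real^'n \<Rightarrow> real^'m"
    and H :: "real^'n \<Rightarrow> real^'n^'m"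
    and U1 :: "(real^'n) set"
    and \<Gamma> :: "real^'n \<Rightarrow> real^'m^'m"
    and \<phi>1 :: "real^'n \<Rightarrow> real^'k"
    and V :: "real^'n \<Rightarrow> real^'k^'n"
    and \<phi>2 :: "real^'n \<Rightarrow> real^'n^'k"
    and \<phi> :: "real^'n \<Rightarrow> real^('m + 'k)"
    and q0 v0 :: "real^'n"
    and I :: "real set"
    and u y ydot :: "real \<Rightarrow> real^'m"
    and q v :: "real \<Rightarrow> real^'n"
    and \<eta>1 \<eta>2 :: "real \<Rightarrow> real^'k"
    and w \<omega> :: "real \<Rightarrow> real^('m + 'k)"
  assumes dim: "CARD('n) = CARD('m) + CARD('k)"
    and M_cont: "continuous_on UNIV M"
    and M_inv: "\<And>x. invertible (M x)"
    and f_cont: "continuous_on UNIV f"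
    and B_cont: "continuous_on UNIV B"
    and h_C1: "C1_on h UNIV"
    and H_eq: "\<And>x. H x = jacobian h (at x)"
    and U1_open: "open U1"
    and \<Gamma>_eq: "\<And>x. x \<in> U1 \<Longrightarrow> \<Gamma> x = H x ** matrix_inv (M x) ** B x"
    and \<Gamma>_inv: "\<And>x. x \<in> U1 \<Longrightarrow> invertible (\<Gamma> x)"
    and \<phi>1_C1: "C1_on \<phi>1 U1"
    and \<phi>1_inv: "\<And>x. x \<in> U1 \<Longrightarrow> invertible (vstack (H x) (jacobian \<phi>1 (at x)))"
    and V_cont: "continuous_on U1 V"
    and V_orth: "\<And>x. x \<in> U1 \<Longrightarrow> orthonormal_columns (V x)"
    and V_im: "\<And>x. x \<in> U1 \<Longrightarrow> matrix_im (V x) = matrix_ker (H x)"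
    and \<phi>2_eq: "\<And>x. x \<in> U1 \<Longrightarrow> \<phi>2 x =
          pseudoinverse (V x) ** (mat 1 - matrix_inv (M x) ** B x ** matrix_inv (\<Gamma> x) ** H x)"
    and \<phi>_eq: "\<And>x. x \<in> U1 \<Longrightarrow> \<phi> x = vstack (h x) (\<phi>1 x)"
    and I_interval: "is_interval I" "0 \<in> I" "I \<noteq> {0}"
    and sol: "solves_system M f B h q0 v0 I u q v y"
    and ydot_eq: "\<And>t. t \<in> I \<Longrightarrow> ydot t = vector_derivative y (at t within I)"
    and \<eta>1_eq: "\<And>t. t \<in> I \<Longrightarrow> q t \<in> U1 \<Longrightarrow> \<eta>1 t = \<phi>1 (q t)"
    and \<eta>2_eq: "\<And>t. t \<in> I \<Longrightarrow> q t \<in> U1 \<Longrightarrow> \<eta>2 t = \<phi>2 (q t) *v v t"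
    and w_eq: "\<And>t. t \<in> I \<Longrightarrow> q t \<in> U1 \<Longrightarrow> w t = vstack (y t) (\<eta>1 t)"
    and \<omega>_eq: "\<And>t. t \<in> I \<Longrightarrow> q t \<in> U1 \<Longrightarrow> \<omega> t = vstack (ydot t) (\<eta>2 t)"
  shows "(\<forall>x\<in>U1. \<exists>U. open U \<and> x \<in> U \<and> U \<subseteq> U1 \<and> C1_diffeomorphism_on \<phi> U) \<and>
    (\<forall>x\<in>U1. invertible (vstack (H x) (\<phi>2 x)) \<and>
       matrix_inv (vstack (H x) (\<phi>2 x)) =
         hstack (matrix_inv (M x) ** B x ** matrix_inv (\<Gamma> x)) (V x)) \<and>
    (\<forall>U. open U \<and> U \<subseteq> U1 \<and> inj_on \<phi> U \<longrightarrow>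
       C1_diffeomorphism_on \<phi> U \<and>
       (let \<psi> = inv_into U \<phi>;
            M\<phi> = M \<circ> \<psi>; B\<phi> = B \<circ> \<psi>; H\<phi> = H \<circ> \<psi>; \<Gamma>\<phi> = \<Gamma> \<circ> \<psi>; V\<phi> = V \<circ> \<psi>;
            d\<phi>1\<phi> = (\<lambda>x. jacobian \<phi>1 (at x)) \<circ> \<psi>;
            \<phi>2\<phi> = \<phi>2 \<circ> \<psi>;
            d\<phi>2\<phi> = (\<lambda>z \<zeta>. deriv_applied \<phi>2 (\<psi> z) (matrix_inv (vstack (H\<phi> z) (\<phi>2\<phi> z)) *v \<zeta>));
            f\<phi> = (\<lambda>z \<zeta>. f (\<psi> z, matrix_inv (vstack (H\<phi> z) (\<phi>2\<phi> z)) *v \<zeta>))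
        in \<forall>t\<in>I. q t \<in> U \<longrightarrow>
          y differentiable (at t within I) \<and>
          (\<eta>1 has_vector_derivative
             (d\<phi>1\<phi> (w t) ** matrix_inv (M\<phi> (w t)) ** B\<phi> (w t) ** matrix_inv (\<Gamma>\<phi> (w t))) *v ydot t
             + (d\<phi>1\<phi> (w t) ** V\<phi> (w t)) *v \<eta>2 t) (at t within I) \<and>
          (\<phi>2 differentiable (at (q t)) \<longrightarrow>
           (\<eta>2 has_vector_derivative
             d\<phi>2\<phi> (w t) (\<omega> t) *v
               ((matrix_inv (M\<phi> (w t)) ** B\<phi> (w t) ** matrix_inv (\<Gamma>\<phi> (w t))) *v ydot t
                + V\<phi> (w t) *v \<eta>2 t)
             + (\<phi>2\<phi> (w t) ** matrix_inv (M\<phi> (w t))) *v f\<phi> (w t) (\<omega> t)) (at t within I))))"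
proof -

  \<comment> \<open>Algebra of \<open>K\<close>, \<open>V\<close> and \<open>\<phi>2\<close>\<close>
  define K where "K = (\<lambda>x. matrix_inv (M x) ** B x ** matrix_inv (\<Gamma> x))"
  \<comment> \<open>On \<open>U1\<close>, \<open>K H\<close> is the projection onto the image of
    \<open>M^-1 B\<close> along the kernel of \<open>H\<close>; \<open>\<phi>2\<close> applies the
    pseudoinverse of \<open>V\<close> to the complementary part.\<close>
  have HK: "H x ** K x = mat 1" if x: "x \<in> U1" for x
    using matrix_inv_rect(1)[OF \<Gamma>_inv[OF x]] \<Gamma>_eq[OF x] by (simp add: K_def matrix_mul_assoc)
  have HV: "H x ** V x = 0" if x: "x \<in> U1" for x
    using V_im[OF x] by (intro matrix_im_le_ker_mult) simp
  have \<phi>2K: "\<phi>2 x = pseudoinverse (V x) ** (mat 1 - K x ** H x)" if x: "x \<in> U1" for x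
    using \<phi>2_eq[OF x] by (simp add: K_def)
  \<comment> \<open>The column type of \<open>A\<close> is left general: the rule is applied to
    \<open>K\<close>, to \<open>V\<close> and to \<open>M^-1 B\<close>.\<close>
  have \<phi>2_mult: "\<phi>2 x ** A = pseudoinverse (V x) ** (A - K x ** (H x ** A))"
    if x: "x \<in> U1" for x and A :: "real^'l^'n"
    unfolding \<phi>2K[OF x]
    by (simp add: matrix_mul_assoc[symmetric]
        bounded_bilinear.diff_left[OF bounded_bilinear_matrix_mult])
  have stack_inv: "vstack (H x) (\<phi>2 x) ** hstack (K x) (V x) = mat 1" if x: "x \<in> U1" for x
  proof -
    have "\<phi>2 x ** K x = 0" "\<phi>2 x ** V x = mat 1"
      using pseudoinverse_orthonormal[OF V_orth[OF x]] by (simp_all add: \<phi>2_mult HK HV x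
          bounded_bilinear.zero_right[OF bounded_bilinear_matrix_mult])
    then show ?thesis
      by (simp add: vstack_mult mult_hstack HK HV x hstack_vstack_mat_1)
  qed
  \<comment> \<open>Block multiplication gives one side only; the other comes from the dimension
    count \<open>dim\<close>.\<close>
  have stack_inv': "hstack (K x) (V x) ** vstack (H x) (\<phi>2 x) = mat 1" if x: "x \<in> U1" for x
    by (rule matrix_right_inverse_imp_left_inverse[OF _ stack_inv[OF x]]) (simp add: dim)
  have inv_stack: "invertible (vstack (H x) (\<phi>2 x))"
    and minv_stack: "matrix_inv (vstack (H x) (\<phi>2 x)) = hstack (K x) (V x)" if x: "x \<in> U1" for x
    using stack_inv[OF x] stack_inv'[OF x] by (auto simp: invertible_def matrix_inv_unique_rect)

  \<comment> \<open>The coordinate map as a local diffeomorphism\<close>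
  have h_der: "(h has_derivative (*v) (H x)) (at x)" for x
    using C1_on_has_derivative[OF h_C1] by (simp add: H_eq)
  have \<phi>1_der: "(\<phi>1 has_derivative (*v) (jacobian \<phi>1 (at x))) (at x)" if "x \<in> U1" for x
    using C1_on_has_derivative[OF \<phi>1_C1 that] .
  have \<phi>_der: "(\<phi> has_derivative (*v) (vstack (H x) (jacobian \<phi>1 (at x)))) (at x)"
    if x: "x \<in> U1" for x
  \<comment> \<open>\<open>\<phi>\<close> is known to be the stacked map only on \<open>U1\<close>;
    openness of \<open>U1\<close> suffices to transfer the derivative.\<close>
  proof (rule has_derivative_transform_within_open[OF _ U1_open x])
    show "((\<lambda>x. vstack (h x) (\<phi>1 x)) has_derivative
        (*v) (vstack (H x) (jacobian \<phi>1 (at x)))) (at x)"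
      unfolding vstack_mult_vec by (rule has_derivative_vstack[OF h_der \<phi>1_der[OF x]])
  qed (simp add: \<phi>_eq)
  have \<phi>_jac: "jacobian \<phi> (at x) = vstack (H x) (jacobian \<phi>1 (at x))" if "x \<in> U1" for x
    using jacobian_eqI[OF \<phi>_der[OF that]] by simp
  have \<phi>_C1: "C1_on \<phi> U1"
  proof -
    have "continuous_on U1 H" "continuous_on U1 (\<lambda>x. jacobian \<phi>1 (at x))"
      using h_C1 \<phi>1_C1 continuous_on_subset by (auto simp: C1_on_def H_eq[abs_def])
    from continuous_on_vstack[OF this] show ?thesis
      unfolding C1_on_def using \<phi>_der differentiableI
      by (simp add: \<phi>_jac cong: continuous_on_cong) blast
  qed
  have \<phi>_diffeo: "C1_diffeomorphism_on \<phi> U" if "open U" "U \<subseteq> U1" "inj_on \<phi> U" for U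
    using that \<phi>_C1 \<phi>1_inv by (intro C1_diffeomorphism_onI) (auto simp: \<phi>_jac C1_on_subset subset_iff)
  have local_diffeo: "\<exists>U. open U \<and> x \<in> U \<and> U \<subseteq> U1 \<and> C1_diffeomorphism_on \<phi> U"
    if x: "x \<in> U1" for x
  proof -
    obtain r where "r > 0" "ball x r \<subseteq> U1" "inj_on \<phi> (ball x r)"
      using C1_on_locally_inj[OF U1_open \<phi>_C1 x] \<phi>1_inv[OF x] \<phi>_jac[OF x] by metis
    then show ?thesis
      using \<phi>_diffeo by (intro exI[of _ "ball x r"]) auto
  qed

  \<comment> \<open>Output velocity along a solution\<close>
  have q_der: "(q has_vector_derivative v t) (at t within I)" if "t \<in> I" for t
    using sol that by (simp add: solves_system_def)
  have y_der: "(y has_vector_derivative H (q t) *v v t) (at t within I)" if t: "t \<in> I" for t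
  proof (rule has_vector_derivative_transform[OF t])
    show "((h \<circ> q) has_vector_derivative H (q t) *v v t) (at t within I)"
      using vector_derivative_diff_chain_within[OF q_der[OF t]
          has_derivative_at_withinI[OF h_der]] .
  qed (use sol in \<open>simp add: solves_system_def\<close>)
  have ydot: "ydot t = H (q t) *v v t" if t: "t \<in> I" for t
    unfolding ydot_eq[OF t]
    by (rule vector_derivative_within[OF _ y_der[OF t]])
      (rule interval_at_within_neq_bot[OF I_interval t])

  \<comment> \<open>Internal dynamics in terms of \<open>q\<close> and \<open>v\<close>\<close>
  have dynamics:
    "v t = K (q t) *v ydot t + V (q t) *v \<eta>2 t"
    "matrix_inv (vstack (H (q t)) (\<phi>2 (q t))) *v \<omega> t = v t"
    "(\<eta>1 has_vector_derivative jacobian \<phi>1 (at (q t)) *v v t) (at t within I)"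
    "\<phi>2 differentiable (at (q t)) \<Longrightarrow>
      (\<eta>2 has_vector_derivative deriv_applied \<phi>2 (q t) (v t) *v v t
        + (\<phi>2 (q t) ** matrix_inv (M (q t))) *v f (q t, v t)) (at t within I)"
    if t: "t \<in> I" and qt: "q t \<in> U1" for t
  proof -
    have \<omega>: "\<omega> t = vstack (H (q t)) (\<phi>2 (q t)) *v v t"
      using t qt by (simp add: \<omega>_eq \<eta>2_eq ydot vstack_mult_vec)
    show inv: "matrix_inv (vstack (H (q t)) (\<phi>2 (q t))) *v \<omega> t = v t"
      using stack_inv'[OF qt] by (simp add: \<omega> minv_stack qt matrix_vector_mul_assoc)
    then show "v t = K (q t) *v ydot t + V (q t) *v \<eta>2 t"
      using t qt by (simp add: minv_stack \<omega>_eq hstack_mult_vstack)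
    have near: "\<forall>\<^sub>F s in at t within I. s \<in> I \<and> q s \<in> U1"
      using eventually_mem_open_within[OF
          has_vector_derivative_continuous[OF q_der[OF t]] U1_open qt]
      by (auto simp: eventually_at_filter elim: eventually_mono)
    have "((\<phi>1 \<circ> q) has_vector_derivative jacobian \<phi>1 (at (q t)) *v v t) (at t within I)"
      using vector_derivative_diff_chain_within[OF q_der[OF t]
          has_derivative_at_withinI[OF \<phi>1_der[OF qt]]] .
    then show "(\<eta>1 has_vector_derivative jacobian \<phi>1 (at (q t)) *v v t) (at t within I)"
      unfolding has_vector_derivative_def
      by (rule has_derivative_transform_eventually)
        (use near t qt in \<open>auto simp: \<eta>1_eq elim: eventually_mono\<close>)
    assume "\<phi>2 differentiable (at (q t))"
    then obtain D where D: "(\<phi>2 has_derivative D) (at (q t))"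
      by (auto simp: differentiable_def)
    have jac: "deriv_applied \<phi>2 (q t) (v t) *v x = D x *v v t" for x
    proof -
      have *: "((\<lambda>x'. \<phi>2 x' *v v t) has_derivative (\<lambda>x. D x *v v t)) (at (q t))"
        by (rule bounded_linear.has_derivative[OF
              bounded_bilinear.bounded_linear_left[OF bounded_bilinear_matrix_vector_mult] D])
      then have "((\<lambda>x'. \<phi>2 x' *v v t) has_derivative
          (*v) (jacobian (\<lambda>x'. \<phi>2 x' *v v t) (at (q t)))) (at (q t))"
        using differentiableI jacobian_works by blast
      from has_derivative_unique[OF this *] show ?thesis
        by (simp add: deriv_applied_def fun_eq_iff)
    qed
    define a where "a = vector_derivative v (at t within I)"
    have a: "(v has_vector_derivative a) (at t within I)"
      and Ma: "M (q t) *v a = f (q t, v t) + B (q t) *v u t"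
      using sol t by (auto simp: solves_system_def a_def vector_derivative_works)
    have "a = matrix_inv (M (q t)) *v (M (q t) *v a)"
      by (simp add: matrix_vector_mul_assoc matrix_inv_rect[OF M_inv])
    then have "\<phi>2 (q t) *v a = (\<phi>2 (q t) ** matrix_inv (M (q t))) *v f (q t, v t)
        + (\<phi>2 (q t) ** (matrix_inv (M (q t)) ** B (q t))) *v u t"
      unfolding Ma by (metis matrix_vector_mul_assoc matrix_vector_right_distrib)
    moreover have "\<phi>2 (q t) ** (matrix_inv (M (q t)) ** B (q t)) = 0"
    proof -
      \<comment> \<open>By definition of \<open>\<Gamma>\<close> the left side is
        \<open>K \<Gamma>\<close>, and \<open>\<Gamma>^-1\<close> inside \<open>K\<close> cancels:
        the projection \<open>K H\<close> fixes \<open>M^-1 B\<close>, so \<open>\<phi>2\<close>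
        annihilates it.\<close>
      have "K (q t) ** (H (q t) ** (matrix_inv (M (q t)) ** B (q t)))
          = matrix_inv (M (q t)) ** B (q t)"
        using matrix_inv_rect(2)[OF \<Gamma>_inv[OF qt]] \<Gamma>_eq[OF qt]
        by (simp add: K_def flip: matrix_mul_assoc)
      then show ?thesis
        by (simp add: \<phi>2_mult[OF qt] bounded_bilinear.zero_right[OF bounded_bilinear_matrix_mult])
    qed
    ultimately have \<phi>2a: "\<phi>2 (q t) *v a = (\<phi>2 (q t) ** matrix_inv (M (q t))) *v f (q t, v t)"
      by simp
    have "((\<phi>2 \<circ> q) has_vector_derivative D (v t)) (at t within I)"
      using vector_derivative_diff_chain_within[OF q_der[OF t] has_derivative_at_withinI[OF D]] .
    from bounded_bilinear.has_vector_derivative[OF bounded_bilinear_matrix_vector_mult this a]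
    have "((\<lambda>s. \<phi>2 (q s) *v v s) has_vector_derivative \<phi>2 (q t) *v a + D (v t) *v v t)
        (at t within I)"
      by simp
    then have "(\<eta>2 has_vector_derivative \<phi>2 (q t) *v a + D (v t) *v v t) (at t within I)"
      unfolding has_vector_derivative_def
      by (rule has_derivative_transform_eventually)
        (use near t qt in \<open>auto simp: \<eta>2_eq elim: eventually_mono\<close>)
    then show "(\<eta>2 has_vector_derivative deriv_applied \<phi>2 (q t) (v t) *v v t
        + (\<phi>2 (q t) ** matrix_inv (M (q t))) *v f (q t, v t)) (at t within I)"
      by (simp add: \<phi>2a jac add.commute)
  qed

  \<comment> \<open>Passage to the coordinates \<open>w\<close> and \<open>\<omega>\<close>\<close>
  show ?thesis
    unfolding Let_def o_def
  proof (intro conjI ballI allI impI)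
    fix U t assume U: "open U \<and> U \<subseteq> U1 \<and> inj_on \<phi> U" and t: "t \<in> I" and qU: "q t \<in> U"
    have qt: "q t \<in> U1"
      using U qU by blast
    \<comment> \<open>With injectivity on \<open>U\<close>, the inverse coordinate map sends
      \<open>w t\<close> back to \<open>q t\<close>, so every function composed with it is evaluated
      at \<open>q t\<close>.\<close>
    have "w t = \<phi> (q t)"
      using sol t qt by (simp add: w_eq \<eta>1_eq \<phi>_eq solves_system_def)
    then have \<psi>: "inv_into U \<phi> (w t) = q t"
      using U qU by simp
    show "y differentiable (at t within I)"
      using y_der[OF t] by (rule differentiableI_vector)
    note dyn = dynamics[OF t qt, unfolded K_def]
    have "(jacobian \<phi>1 (at (q t)) ** matrix_inv (M (q t)) ** B (q t) ** matrix_inv (\<Gamma> (q t))) *v ydot t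
        + (jacobian \<phi>1 (at (q t)) ** V (q t)) *v \<eta>2 t = jacobian \<phi>1 (at (q t)) *v v t"
      by (subst dyn(1)) (simp add: matrix_vector_right_distrib matrix_vector_mul_assoc matrix_mul_assoc)
    then show "(\<eta>1 has_vector_derivative
        (jacobian \<phi>1 (at (inv_into U \<phi> (w t))) ** matrix_inv (M (inv_into U \<phi> (w t)))
           ** B (inv_into U \<phi> (w t)) ** matrix_inv (\<Gamma> (inv_into U \<phi> (w t)))) *v ydot t
        + (jacobian \<phi>1 (at (inv_into U \<phi> (w t))) ** V (inv_into U \<phi> (w t))) *v \<eta>2 t)
        (at t within I)"
      using dyn(3) by (simp add: \<psi>)
    assume "\<phi>2 differentiable (at (q t))"
    then show "(\<eta>2 has_vector_derivative
        deriv_applied \<phi>2 (inv_into U \<phi> (w t))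
          (matrix_inv (vstack (H (inv_into U \<phi> (w t))) (\<phi>2 (inv_into U \<phi> (w t)))) *v \<omega> t) *v
        ((matrix_inv (M (inv_into U \<phi> (w t))) ** B (inv_into U \<phi> (w t))
            ** matrix_inv (\<Gamma> (inv_into U \<phi> (w t)))) *v ydot t
          + V (inv_into U \<phi> (w t)) *v \<eta>2 t)
        + (\<phi>2 (inv_into U \<phi> (w t)) ** matrix_inv (M (inv_into U \<phi> (w t)))) *v
          f (inv_into U \<phi> (w t),
            matrix_inv (vstack (H (inv_into U \<phi> (w t))) (\<phi>2 (inv_into U \<phi> (w t)))) *v \<omega> t))
        (at t within I)"
      using dyn(4) by (simp only: \<psi> dyn(2) dyn(1)[symmetric])
  qed (use local_diffeo \<phi>_diffeo inv_stack minv_stack in \<open>auto simp: K_def\<close>)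
qed

end
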